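(* Let $\{p_k\}_{k\in\mathbb{Z}}$ be a real sequence with $1<p^-\le p^+<\infty$, where $p^-:=\inf_{k}p_k$ and $p^+:=\sup_k p_k$; let $a,b:\mathbb{Z}\to(0,+\infty)$ and let $f_k:\mathbb{R}\to\mathbb{R}$, $k\in\mathbb{Z}$, be continuous, with $F_k(t):=\int_0^t f_k(s)\,ds$. Assume: (A) $b_k\to+\infty$ as $|k|\to\infty$ (so that $\alpha:=\sup_{k\in\mathbb{Z}}b_k^{-1/p_k}<\infty$); (F1) $f_k(0)=0$ for all $k\in\mathbb{Z}$; (F2) $\sum_{k\in\mathbb{Z}}\max_{|t|\le T}|f_k(t)|<\infty$ for every $T>0$; (F4) $\displaystyle\liminf_{t\to0^+}\frac{\sum_{k\in\mathbb{Z}}\max_{|\xi|\le t}F_k(\xi)}{t^{p^+}}<\frac{1}{p^+\alpha^{p^+}}$. Assume moreover that at least one of the following two conditions holds: (F5) $\displaystyle\max\left\{\limsup_{(k,t)\to(+\infty,0^+)}\frac{F_k(t)}{(a_{k-1}+a_k+b_k)t^{p^-}},\ \limsup_{(k,t)\to(-\infty,0^+)}\frac{F_k(t)}{(a_{k-1}+a_k+b_k)t^{p^-}}\right\}>\frac1{p^-}$; (F6) $\displaystyle\sup_{k\in\mathbb{Z}}\left(\limsup_{t\to0^+}\frac{F_k(t)}{(a_{k-1}+a_k+b_k)t^{p^-}}\right)>\frac1{p^-}$. Then the problem $$-\nabla^-\left(a_k|\nabla^+u_k|^{p_k-2}\nabla^+u_k\right)+b_k|u_k|^{p_k-2}u_k=f_k(u_k)\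 \ (k\in\mathbb{Z}),\qquad u_k\to0\ \text{ as } |k|\to\infty,$$ possesses a sequence $\{u^n\}_{n\in\mathbb{N}}\subset E$ of positive solutions (i.e. $u^n_k>0$ for all $k\in\mathbb{Z}$) with $\|u^n\|_E\to0$ as $n\to\infty$.
   Context: Notation: for $u:\mathbb{Z}\to\mathbb{R}$, $\nabla^-u_k=u_k-u_{k-1}$ and $\nabla^+u_k=u_{k+1}-u_k$; in particular $\nabla^-$ in the equation acts on the sequence $k\mapsto a_k|\nabla^+u_k|^{p_k-2}\nabla^+u_k$. The expression $|x|^{p-2}x$ is understood as $0$ at $x=0$. $l^{p_k}(\mathbb{Z})=\{u:\mathbb{Z}\to\mathbb{R}:\sum_{k\in\mathbb{Z}}|u_k|^{p_k}<\infty\}$, and $$E=\Big\{u\in l^{p_k}(\mathbb{Z}):\ \sum_{k\in\mathbb{Z}}\big(a_k|\nabla^+u_k|^{p_k}+b_k|u_k|^{p_k}\big)<\infty\Big\},$$ with norm $\|u\|_E=\inf\{\eta>0:\sum_{k\in\mathbb{Z}}(a_k|\nabla^+u_k/\eta|^{p_k}+b_k|u_k/\eta|^{p_k})\le1\}$. The limsup as $(k,t)\to(+\infty,0^+)$ (resp. $(-\infty,0^+)$) is the joint upper limit: $\lim_{N\to\infty}$ of the supremum over all integers $k\ge N$ (resp. $k\le -N$) and reals $0<t<1/N$. *)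

theory Defs
  imports "HOL-Analysis.Analysis"
begin

definition bdiff :: "(int \<Rightarrow> real) \<Rightarrow> int \<Rightarrow> real" where
  "bdiff u k = u k - u (k - 1)"

definition fdiff :: "(int \<Rightarrow> real) \<Rightarrow> int \<Rightarrow> real" where
  "fdiff u k = u (k + 1) - u k"

text \<open>The map \<open>x \<mapsto> |x|^(q-2) x\<close>; its value at 0 is 0 by the factor \<open>x\<close>, also for \<open>q < 2\<close>.\<close>

definition signed_pow :: "real \<Rightarrow> real \<Rightarrow> real" where
  "signed_pow q x = \<bar>x\<bar> powr (q - 2) * x"

definition p_minus :: "(int \<Rightarrow> real) \<Rightarrow> real" where
  "p_minus p = (INF k. p k)"

definition p_plus :: "(int \<Rightarrow> real) \<Rightarrow> real" where
  "p_plus p = (SUP k. p k)"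

definition embed_const :: "(int \<Rightarrow> real) \<Rightarrow> (int \<Rightarrow> real) \<Rightarrow> real" where
  "embed_const p b = (SUP k. b k powr (- 1 / p k))"

text \<open>Oriented integral: for \<open>t < 0\<close> it is minus the integral over \<open>[t, 0]\<close>.\<close>

definition primitive :: "(int \<Rightarrow> real \<Rightarrow> real) \<Rightarrow> int \<Rightarrow> real \<Rightarrow> real" where
  "primitive f k t = (LBINT s=ereal 0..ereal t. f k s)"

definition lp_var :: "(int \<Rightarrow> real) \<Rightarrow> (int \<Rightarrow> real) set" where
  "lp_var p = {u. (\<lambda>k. \<bar>u k\<bar> powr p k) summable_on UNIV}"

definition energy_density ::
    "(int \<Rightarrow> real) \<Rightarrow> (int \<Rightarrow> real) \<Rightarrow> (int \<Rightarrow> real) \<Rightarrow> (int \<Rightarrow> real) \<Rightarrow> int \<Rightarrow> real" where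
  "energy_density p a b u k = a k * \<bar>fdiff u k\<bar> powr p k + b k * \<bar>u k\<bar> powr p k"

definition E_space ::
    "(int \<Rightarrow> real) \<Rightarrow> (int \<Rightarrow> real) \<Rightarrow> (int \<Rightarrow> real) \<Rightarrow> (int \<Rightarrow> real) set" where
  "E_space p a b = {u \<in> lp_var p. energy_density p a b u summable_on UNIV}"

text \<open>The summability conjunct is needed because \<open>infsum\<close> of a non-summable family is 0.\<close>

definition E_norm ::
    "(int \<Rightarrow> real) \<Rightarrow> (int \<Rightarrow> real) \<Rightarrow> (int \<Rightarrow> real) \<Rightarrow> (int \<Rightarrow> real) \<Rightarrow> real" where
  "E_norm p a b u = Inf {\<eta>. \<eta> > 0 \<and>
     (\<lambda>k. a k * \<bar>fdiff u k / \<eta>\<bar> powr p k + b k * \<bar>u k / \<eta>\<bar> powr p k) summable_on UNIV \<and>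
     (\<Sum>\<^sub>\<infinity>k. a k * \<bar>fdiff u k / \<eta>\<bar> powr p k + b k * \<bar>u k / \<eta>\<bar> powr p k) \<le> 1}"

text \<open>The filter \<open>|k| \<rightarrow> \<infinity>\<close> on the integers.\<close>

definition at_inf_int :: "int filter" where
  "at_inf_int = filtercomap (\<lambda>k. \<bar>k\<bar>) at_top"

definition solution ::
    "(int \<Rightarrow> real) \<Rightarrow> (int \<Rightarrow> real) \<Rightarrow> (int \<Rightarrow> real) \<Rightarrow> (int \<Rightarrow> real \<Rightarrow> real) \<Rightarrow> (int \<Rightarrow> real) \<Rightarrow> bool" where
  "solution p a b f u \<longleftrightarrow>
     (\<forall>k. - bdiff (\<lambda>j. a j * signed_pow (p j) (fdiff u j)) k + b k * signed_pow (p k) (u k)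
            = f k (u k)) \<and>
     (u \<longlongrightarrow> 0) at_inf_int"

definition growth_ratio ::
    "(int \<Rightarrow> real) \<Rightarrow> (int \<Rightarrow> real) \<Rightarrow> (int \<Rightarrow> real) \<Rightarrow> (int \<Rightarrow> real \<Rightarrow> real) \<Rightarrow> int \<Rightarrow> real \<Rightarrow> real" where
  "growth_ratio p a b f k t =
     primitive f k t / ((a (k - 1) + a k + b k) * t powr p_minus p)"

end

theory Submission
  imports Defs
begin

text \<open>Minimise the action
  \<open>\<Sum>k. (a\<^sub>k |\<nabla>u\<^sub>k|^p\<^sub>k + b\<^sub>k |u\<^sub>k|^p\<^sub>k) / p\<^sub>k - F\<^sub>k(u\<^sub>k)\<close> over the box
  \<open>0 \<le> u\<^sub>k \<le> t\<close>, which is compact in the product topology, for small \<open>t\<close> supplied by (F4).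
  Comparing with \<open>u = 0\<close>, (F4) bounds the energy of the minimiser so strongly that
  \<open>u\<^sub>k < t\<close> for all \<open>k\<close>; hence only the constraint \<open>u\<^sub>k \<ge> 0\<close> can be active. Varying a single
  coordinate shows that the \<open>k\<close>-th equation holds when \<open>u\<^sub>k > 0\<close>, whereas \<open>u\<^sub>k = 0\<close> forces
  \<open>u\<^sub>k\<^sub>-\<^sub>1 = u\<^sub>k\<^sub>+\<^sub>1 = 0\<close> because \<open>f\<^sub>k(0) = 0\<close>. So the minimiser is either a positive solution or
  identically zero, and (F5) or (F6) excludes the latter. The energy tends to 0 with \<open>t\<close>.\<close>

section \<open>Minimising infinite sums over compact sets\<close>

text \<open>The infinite sum need not be continuous, but its finite partial sums are. So a minimiser
  is sought as a point whose every finite partial sum is at most the total of every summable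
  competitor. Each such constraint is closed, and finitely many of them are met by the best of the
  competitors involved, so the finite intersection property applies.\<close>

lemma compact_infsum_minimizer:
  fixes g :: "'k \<Rightarrow> 'x::t2_space \<Rightarrow> real"
  assumes X: "compact X"
    and cont: "\<And>k. continuous_on X (g k)"
    and nonneg: "\<And>k x. x \<in> X \<Longrightarrow> 0 \<le> g k x"
    and v0: "v0 \<in> X" "(\<lambda>k. g k v0) summable_on UNIV"
  obtains x where "x \<in> X" "(\<lambda>k. g k x) summable_on UNIV"
    "\<And>v. v \<in> X \<Longrightarrow> (\<lambda>k. g k v) summable_on UNIV \<Longrightarrow> (\<Sum>\<^sub>\<infinity>k. g k x) \<le> (\<Sum>\<^sub>\<infinity>k. g k v)"
proof -
  define V where "V = {v \<in> X. (\<lambda>k. g k v) summable_on UNIV}"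
  define J where "J v = (\<Sum>\<^sub>\<infinity>k. g k v)" for v
  define C where "C = (\<lambda>(S, v). {x \<in> X. (\<Sum>k\<in>S. g k x) \<le> J v})"
  have partial: "(\<Sum>k\<in>S. g k v) \<le> J v" if "finite S" "v \<in> V" for S v
    unfolding J_def using that nonneg by (intro finite_sum_le_infsum) (auto simp: V_def)
  have "X \<inter> (\<Inter>i\<in>Collect finite \<times> V. C i) \<noteq> {}"
  proof (rule compact_imp_fip_image[OF X])
    fix i :: "'k set \<times> 'x" assume "i \<in> Collect finite \<times> V"
    show "closed (C i)"
      unfolding C_def split_beta
      by (intro continuous_on_closed_Collect_le continuous_intros cont compact_imp_closed X)
  next
    fix I assume I: "finite I" "(I :: ('k set \<times> 'x) set) \<subseteq> Collect finite \<times> V"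
    \<comment> \<open>Inserting \<open>v0\<close> keeps the set of competitors nonempty even when
      \<open>I\<close> is empty.\<close>
    define W where "W = insert v0 (snd ` I)"
    have W: "finite W" "W \<noteq> {}" "W \<subseteq> V"
      using I v0 by (auto simp: W_def V_def)
    define v where "v = arg_min_on J W"
    have v: "v \<in> W" "\<And>w. w \<in> W \<Longrightarrow> J v \<le> J w"
      unfolding v_def using W by (auto intro: arg_min_if_finite(1) arg_min_least)
    have "v \<in> C (S, w)" if "(S, w) \<in> I" for S w
    proof -
      have "finite S" "w \<in> W"
        using that I by (force simp: W_def)+
      then have "(\<Sum>k\<in>S. g k v) \<le> J w"
        using partial[of S v] v W by (meson order_trans subsetD)
      then show ?thesis
        using v(1) W(3) by (auto simp: C_def V_def)
    qed
    moreover have "v \<in> X" using v(1) W(3) by (auto simp: V_def)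
    ultimately show "X \<inter> (\<Inter>i\<in>I. C i) \<noteq> {}" by fast
  qed
  then obtain x where x: "x \<in> X" and "\<And>i. i \<in> Collect finite \<times> V \<Longrightarrow> x \<in> C i"
    by blast
  then have le: "(\<Sum>k\<in>S. g k x) \<le> J v" if "finite S" "v \<in> V" for S v
    using that by (force simp: C_def)
  have v0V: "v0 \<in> V" using v0 by (simp add: V_def)
  have summ: "(\<lambda>k. g k x) summable_on UNIV"
    by (rule nonneg_bdd_above_summable_on) (auto simp: nonneg x intro!: bdd_aboveI2 le v0V)
  show thesis
  proof
    fix v assume "v \<in> X" "(\<lambda>k. g k v) summable_on UNIV"
    then have "v \<in> V" by (simp add: V_def)
    then show "(\<Sum>\<^sub>\<infinity>k. g k x) \<le> (\<Sum>\<^sub>\<infinity>k. g k v)"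
      using infsum_le_finite_sums[OF summ, of "J v"] le by (simp add: J_def)
  qed (use x summ in auto)
qed

text \<open>Tychonoff's theorem, transferred to the type class topology on functions.\<close>

lemma compact_PiE_UNIV:
  fixes K :: "'i \<Rightarrow> 'a::t2_space set"
  assumes "\<And>i. compact (K i)"
  shows "compact (PiE UNIV K)"
proof -
  have "compactin (product_topology (\<lambda>i. euclidean) UNIV) (PiE UNIV K)"
    using assms by (simp add: compactin_PiE)
  then show ?thesis by (simp add: euclidean_product_topology)
qed

section \<open>Calculus of |x|^q and of the primitives F_k\<close>

text \<open>Away from 0 this is the power rule on either side. At 0 the difference quotient has size
  |h|^(q-1), which vanishes because q > 1.\<close>

lemma has_real_derivative_abs_powr:
  assumes q: "1 < q"
  shows "((\<lambda>x. \<bar>x\<bar> powr q) has_real_derivative q * signed_pow q x) (at x)"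
proof (cases x "0::real" rule: linorder_cases)
  case equal
  have "((\<lambda>h. \<bar>h\<bar> powr q / h) \<longlongrightarrow> 0) (at (0::real))"
  proof (rule Lim_null_comparison)
    show "\<forall>\<^sub>F h in at (0::real). norm (\<bar>h\<bar> powr q / h) \<le> \<bar>h\<bar> powr (q - 1)"
      by (auto simp: eventually_at powr_diff intro!: exI[of _ 1])
    show "((\<lambda>h. \<bar>h\<bar> powr (q - 1)) \<longlongrightarrow> 0) (at (0::real))"
      using q by (intro tendsto_eq_intros | force)+
  qed
  then show ?thesis
    using equal by (simp add: has_field_derivative_iff signed_pow_def)
next
  case greater
  have "((\<lambda>x. x powr q) has_real_derivative q * signed_pow q x) (at x)"
    using greater by (auto intro!: derivative_eq_intros
      simp: signed_pow_def powr_diff field_simps power2_eq_square)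
  then show ?thesis
    by (rule has_field_derivative_transform_within_open[of _ _ _ "{0<..}"]) (use greater in auto)
next
  case less
  have "((\<lambda>x. (- x) powr q) has_real_derivative q * signed_pow q x) (at x)"
    using less by (auto intro!: derivative_eq_intros
      simp: signed_pow_def powr_diff field_simps power2_eq_square)
  then show ?thesis
    by (rule has_field_derivative_transform_within_open[of _ _ _ "{..<0}"]) (use less in auto)
qed

lemma primitive_has_real_derivative:
  assumes "continuous_on UNIV (f k)"
  shows "(primitive f k has_real_derivative f k x) (at x)"
proof -
  \<comment> \<open>The interval [-T, T] contains 0 and has x in its interior, so the derivative
    within it is the full derivative at x.\<close>
  define T where "T = \<bar>x\<bar> + 1"
  have x: "x \<in> {-T<..<T}" by (auto simp: T_def)
  have "((\<lambda>t. LBINT s=ereal 0..t. f k s) has_vector_derivative f k x) (at x within {-T..T})"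
    by (rule interval_integral_FTC2) (use x assms in \<open>auto intro: continuous_on_subset\<close>)
  moreover have "(\<lambda>t. LBINT s=ereal 0..t. f k s) = primitive f k"
    by (simp add: primitive_def fun_eq_iff)
  moreover have "at x within {-T..T} = at x"
    using x by (intro at_within_interior) simp
  ultimately show ?thesis
    by (simp add: has_real_derivative_iff_has_vector_derivative)
qed

lemma primitive_0 [simp]: "primitive f k 0 = 0"
  by (simp add: primitive_def)

lemma continuous_on_primitive:
  assumes "continuous_on UNIV (f k)"
  shows "continuous_on S (primitive f k)"
  by (rule DERIV_continuous_on[of _ _ "f k"])
    (auto intro: has_field_derivative_at_within primitive_has_real_derivative assms)

section \<open>Suprema of the primitives over [-t, t]\<close>

lemma bdd_above_image_Icc:
  fixes h :: "real \<Rightarrow> real"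
  assumes "continuous_on UNIV h"
  shows "bdd_above (h ` {r..s})"
  using assms by (meson bounded_imp_bdd_above compact_Icc compact_continuous_image
      compact_imp_bounded continuous_on_subset top_greatest)

context
  fixes f :: "int \<Rightarrow> real \<Rightarrow> real"
  assumes f_cont: "\<And>k. continuous_on UNIV (f k)"
begin

lemma primitive_le_Sup:
  assumes "\<bar>x\<bar> \<le> t"
  shows "primitive f k x \<le> (SUP \<xi>\<in>{-t..t}. primitive f k \<xi>)"
  using assms by (intro cSUP_upper bdd_above_image_Icc continuous_on_primitive f_cont) auto

lemma primitive_Sup_nonneg:
  assumes "0 \<le> t"
  shows "0 \<le> (SUP \<xi>\<in>{-t..t}. primitive f k \<xi>)"
  using primitive_le_Sup[of 0 t k] assms by simp

text \<open>By the mean value inequality and F_k(0) = 0, each supremum is at most t times the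
  maximum of |f_k| on [-t, t]. Thus (F2) makes the series in (F4) converge.\<close>

lemma primitive_Sup_summable:
  assumes F2: "(\<lambda>k. SUP s\<in>{-t..t}. \<bar>f k s\<bar>) summable_on UNIV" and t: "0 < t"
  shows "(\<lambda>k. SUP \<xi>\<in>{-t..t}. primitive f k \<xi>) summable_on UNIV"
proof (rule summable_on_comparison_test)
  show "(\<lambda>k. t * (SUP s\<in>{-t..t}. \<bar>f k s\<bar>)) summable_on UNIV"
    by (intro summable_on_cmult_right F2)
  fix k
  define m where "m = (SUP s\<in>{-t..t}. \<bar>f k s\<bar>)"
  have m: "\<bar>f k s\<bar> \<le> m" if "s \<in> {-t..t}" for s
    unfolding m_def using that
    by (intro cSUP_upper bdd_above_image_Icc continuous_intros f_cont)
  have "primitive f k \<xi> \<le> t * m" if \<xi>: "\<xi> \<in> {-t..t}" for \<xi>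
  proof -
    have "norm (primitive f k \<xi> - primitive f k 0) \<le> m * norm (\<xi> - 0)"
      by (rule field_differentiable_bound[of "{-t..t}"])
        (use m \<xi> t in \<open>auto intro: has_field_derivative_at_within
           primitive_has_real_derivative[OF f_cont]\<close>)
    also have "\<dots> \<le> m * t"
      using \<xi> m[OF \<xi>] by (intro mult_left_mono) auto
    finally show ?thesis by (simp add: mult.commute)
  qed
  then show "(SUP \<xi>\<in>{-t..t}. primitive f k \<xi>) \<le> t * (SUP s\<in>{-t..t}. \<bar>f k s\<bar>)"
    unfolding m_def[symmetric] using t by (intro cSUP_least) auto
qed (use t primitive_Sup_nonneg in simp)

end

section \<open>Varying one coordinate of the action\<close>

text \<open>Lets the totals of two sequences that differ in one coordinate be compared through the
  finitely many terms affected.\<close>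

lemma has_sum_change_finite:
  fixes f g :: "'k \<Rightarrow> real"
  assumes "f summable_on UNIV" "finite S" "\<And>j. j \<notin> S \<Longrightarrow> g j = f j"
  shows "(g has_sum (infsum f UNIV + (sum g S - sum f S))) UNIV"
proof -
  have "((\<lambda>j. g j - f j) has_sum (sum g S - sum f S)) UNIV"
    by (rule has_sum_finite_neutralI[of S]) (use assms in \<open>auto simp: sum_subtractf\<close>)
  from has_sum_add[OF has_sum_infsum[OF assms(1)] this] show ?thesis by simp
qed

lemma has_real_derivative_abs_powr_chain:
  assumes "(g has_real_derivative g') (at x within S)" "1 < q"
  shows "((\<lambda>x. \<bar>g x\<bar> powr q) has_real_derivative q * signed_pow q (g x) * g') (at x within S)"
  using DERIV_chain2[OF has_real_derivative_abs_powr[OF assms(2)] assms(1)] .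

lemma signed_pow_0 [simp]: "signed_pow q 0 = 0"
  by (simp add: signed_pow_def)

lemma signed_pow_pos: "0 < x \<Longrightarrow> 0 < signed_pow q x"
  by (simp add: signed_pow_def)

lemma signed_pow_minus: "signed_pow q (- x) = - signed_pow q x"
  by (simp add: signed_pow_def)

text \<open>The supremum is added to make every term nonnegative; it shifts the variational functional
  by a constant.\<close>

definition shifted_action ::
    "(int \<Rightarrow> real) \<Rightarrow> (int \<Rightarrow> real) \<Rightarrow> (int \<Rightarrow> real) \<Rightarrow> (int \<Rightarrow> real \<Rightarrow> real) \<Rightarrow> real
      \<Rightarrow> int \<Rightarrow> (int \<Rightarrow> real) \<Rightarrow> real" where
  "shifted_action p a b f t k u =
     energy_density p a b u k / p k + ((SUP \<xi>\<in>{-t..t}. primitive f k \<xi>) - primitive f k (u k))"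

lemma energy_density_nonneg:
  assumes "0 < a k" "0 < b k"
  shows "0 \<le> energy_density p a b u k"
  using assms by (simp add: energy_density_def)

text \<open>The partial derivative of the action in the k-th coordinate. The k-th equation says that
  it vanishes.\<close>

definition residual ::
    "(int \<Rightarrow> real) \<Rightarrow> (int \<Rightarrow> real) \<Rightarrow> (int \<Rightarrow> real) \<Rightarrow> (int \<Rightarrow> real \<Rightarrow> real)
      \<Rightarrow> (int \<Rightarrow> real) \<Rightarrow> int \<Rightarrow> real" where
  "residual p a b f u k =
     - bdiff (\<lambda>j. a j * signed_pow (p j) (fdiff u j)) k + b k * signed_pow (p k) (u k) - f k (u k)"

text \<open>The coordinate u_k enters term k directly and term k - 1 through the forward difference
  there, and no others.\<close>

lemma shifted_action_upd_other:
  assumes "j \<notin> {k - 1, k}"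
  shows "shifted_action p a b f t j (u(k := s)) = shifted_action p a b f t j u"
proof -
  have "j + 1 \<noteq> k" using assms by auto
  then show ?thesis
    using assms by (simp add: shifted_action_def energy_density_def fdiff_def)
qed

text \<open>The two terms containing u_k carry the whole partial derivative. The factors p_j
  produced by differentiation cancel against the weights 1/p_j of the action.\<close>

lemma shifted_action_upd_derivative:
  assumes p: "\<And>k. 1 < p k" and f: "\<And>k. continuous_on UNIV (f k)"
  shows "((\<lambda>s. \<Sum>j\<in>{k - 1, k}. shifted_action p a b f t j (u(k := s)))
            has_real_derivative residual p a b f u k) (at (u k))"
proof -
  have p0: "p k \<noteq> 0" for k using p[of k] by simp
  have 1: "((\<lambda>s. \<bar>s - u (k - 1)\<bar> powr p (k - 1)) has_real_derivative
      p (k - 1) * signed_pow (p (k - 1)) (u k - u (k - 1)) * 1) (at (u k))"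
    by (rule has_real_derivative_abs_powr_chain) (auto intro!: derivative_eq_intros p)
  have 2: "((\<lambda>s. \<bar>u (k + 1) - s\<bar> powr p k) has_real_derivative
      p k * signed_pow (p k) (u (k + 1) - u k) * (- 1)) (at (u k))"
    by (rule has_real_derivative_abs_powr_chain) (auto intro!: derivative_eq_intros p)
  \<comment> \<open>The two terms with the update written out; \<open>c\<close> and \<open>d\<close>
    stand for the constant suprema.\<close>
  have *: "((\<lambda>s. (a (k - 1) * \<bar>s - u (k - 1)\<bar> powr p (k - 1) + b (k - 1) * \<bar>u (k - 1)\<bar> powr p (k - 1))
        / p (k - 1) + (c - primitive f (k - 1) (u (k - 1)))
      + ((a k * \<bar>u (k + 1) - s\<bar> powr p k + b k * \<bar>s\<bar> powr p k) / p k + (d - primitive f k s)))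
    has_real_derivative
      (a (k - 1) * (p (k - 1) * signed_pow (p (k - 1)) (u k - u (k - 1)) * 1) + 0) / p (k - 1) + 0
      + ((a k * (p k * signed_pow (p k) (u (k + 1) - u k) * (- 1)) + b k * (p k * signed_pow (p k) (u k)))
          / p k + (0 - f k (u k)))) (at (u k))" for c d
    by (intro DERIV_add DERIV_diff DERIV_cdivide DERIV_cmult DERIV_const 1 2
        has_real_derivative_abs_powr p primitive_has_real_derivative f)
  show ?thesis
    by (rule DERIV_cong[OF *[of "SUP \<xi>\<in>{-t..t}. primitive f (k - 1) \<xi>"
            "SUP \<xi>\<in>{-t..t}. primitive f k \<xi>", THEN has_field_derivative_transform_within[OF _ zero_less_one]]])
      (simp_all add: residual_def bdiff_def fdiff_def shifted_action_def energy_density_def p0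
         add_divide_distrib diff_divide_distrib)
qed

lemma continuous_on_shifted_action:
  assumes p: "\<And>k. 1 < p k" and f: "\<And>k. continuous_on UNIV (f k)"
  shows "continuous_on X (shifted_action p a b f t k)"
proof -
  have p0: "0 < p k" for k using p[of k] by simp
  have coord: "continuous_on X (\<lambda>u. u i)" for i :: int and X :: "(int \<Rightarrow> real) set"
    by (rule continuous_on_subset[OF continuous_on_product_coordinates]) simp
  have "continuous_on X (\<lambda>u. primitive f k (u k))"
    by (rule continuous_on_compose2[OF continuous_on_primitive[of f k UNIV] coord]) (auto simp: f)
  then show ?thesis
    unfolding shifted_action_def energy_density_def fdiff_def
    using p0[of k] by (intro continuous_intros continuous_on_powr' coord) auto
qed

section \<open>A positive solution of small energy\<close>

text \<open>Turns a bound on b_k^(-1/p_k), such as the one by \<alpha>, into a lower bound on b_k.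
  Equality holds at C = c^(-1/q), and C^q increases with C.\<close>

lemma one_le_mult_powr:
  fixes c :: real
  assumes "0 < c" "0 < q" "c powr (- 1 / q) \<le> C"
  shows "1 \<le> c * C powr q"
proof -
  have "c * (c powr (- 1 / q)) powr q = 1"
    using assms(1,2) by (subst powr_powr) (simp add: powr_minus_divide)
  moreover have "(c powr (- 1 / q)) powr q \<le> C powr q"
    using assms by (intro powr_mono2) auto
  ultimately show ?thesis
    using assms(1) mult_left_mono[of "(c powr (- 1 / q)) powr q" "C powr q" c] by linarith
qed

text \<open>Here (F4) enters through one value t, and (F5) or (F6) through one index i and one value
  s. The energy bound in the conclusion later yields the smallness of the norm.\<close>

lemma small_positive_solution:
  fixes p a b :: "int \<Rightarrow> real" and f :: "int \<Rightarrow> real \<Rightarrow> real"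
  assumes p_bounds: "\<And>k. P' \<le> p k" "\<And>k. p k \<le> P" "1 < P'"
    and a_pos: "\<And>k. 0 < a k"
    and b_pos: "\<And>k. 0 < b k"
    and f_cont: "\<And>k. continuous_on UNIV (f k)"
    and F1: "\<And>k. f k 0 = 0"
    and \<alpha>: "\<And>k. b k powr (- 1 / p k) \<le> \<alpha>"
    and t: "0 < t" "t \<le> \<alpha>"
    and M_summable: "(\<lambda>k. SUP \<xi>\<in>{-t..t}. primitive f k \<xi>) summable_on UNIV"
    and M_small: "(\<Sum>\<^sub>\<infinity>k. SUP \<xi>\<in>{-t..t}. primitive f k \<xi>) < t powr P / (P * \<alpha> powr P)"
    and s: "0 < s" "s \<le> t" "s \<le> 1"
    and growth: "(a (i - 1) + a i + b i) * s powr P' / P' < primitive f i s"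
  obtains u where "\<And>k. 0 < u k" "\<And>k. residual p a b f u k = 0"
    "energy_density p a b u summable_on UNIV"
    "(\<Sum>\<^sub>\<infinity>k. energy_density p a b u k) \<le> P * (\<Sum>\<^sub>\<infinity>k. SUP \<xi>\<in>{-t..t}. primitive f k \<xi>)"
proof -
  have p1: "1 < p k" and p0: "0 < p k" for k
    using p_bounds(1)[of k] p_bounds(3) by linarith+
  define M where "M k = (SUP \<xi>\<in>{-t..t}. primitive f k \<xi>)" for k
  define A where "A = shifted_action p a b f t"
  define X where "X = (PiE UNIV (\<lambda>_. {0..t}) :: (int \<Rightarrow> real) set)"
  have X_iff: "u \<in> X \<longleftrightarrow> (\<forall>k. 0 \<le> u k \<and> u k \<le> t)" for u
    by (auto simp: X_def PiE_iff)
  have FM: "primitive f k x \<le> M k" if "\<bar>x\<bar> \<le> t" for k x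
    unfolding M_def by (rule primitive_le_Sup[OF f_cont that])
  have energy_nonneg: "0 \<le> energy_density p a b u k" for u k
    by (rule energy_density_nonneg[OF a_pos b_pos])
  have energy_le_A: "energy_density p a b u k / p k \<le> A k u" if "u \<in> X" for u k
    using FM[of "u k" k] that by (auto simp: A_def shifted_action_def M_def X_iff)
  have A_0: "A k (\<lambda>_. 0) = M k" for k
    by (simp add: A_def shifted_action_def energy_density_def fdiff_def M_def)
  have X_0: "(\<lambda>_. 0) \<in> X" using t by (simp add: X_iff)
  obtain u where u: "u \<in> X" and u_summable: "(\<lambda>k. A k u) summable_on UNIV"
    and min: "\<And>v. v \<in> X \<Longrightarrow> (\<lambda>k. A k v) summable_on UNIV \<Longrightarrow> (\<Sum>\<^sub>\<infinity>k. A k u) \<le> (\<Sum>\<^sub>\<infinity>k. A k v)"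
  proof (rule compact_infsum_minimizer[of X A "\<lambda>_. 0"])
    show "compact X"
      unfolding X_def by (intro compact_PiE_UNIV) simp
    show "continuous_on X (A k)" for k
      unfolding A_def by (intro continuous_on_shifted_action p1 f_cont)
    show "0 \<le> A k x" if "x \<in> X" for k x
      using energy_le_A[OF that, of k] energy_nonneg[of x k] p0[of k]
      by (meson divide_nonneg_pos order_trans)
    show "(\<lambda>k. A k (\<lambda>_. 0)) summable_on UNIV"
      using M_summable by (simp add: A_0 M_def)
  qed (use X_0 in auto)

  have e_summable: "(\<lambda>k. energy_density p a b u k / p k) summable_on UNIV"
    by (rule summable_on_comparison_test[OF u_summable])
      (use energy_le_A[OF u] energy_nonneg p0 in \<open>auto simp: less_imp_le\<close>)
  \<comment> \<open>On the box the part of the action involving F_k is nonnegative, so the action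
    dominates the weighted energy. At the zero sequence it equals the sum of the suprema.\<close>
  have "(\<Sum>\<^sub>\<infinity>k. energy_density p a b u k / p k) \<le> (\<Sum>\<^sub>\<infinity>k. A k u)"
    by (intro infsum_mono e_summable u_summable energy_le_A u)
  also have "\<dots> \<le> (\<Sum>\<^sub>\<infinity>k. M k)"
    using min[OF X_0] M_summable by (simp add: A_0 M_def)
  finally have e_le: "(\<Sum>\<^sub>\<infinity>k. energy_density p a b u k / p k) \<le> (\<Sum>\<^sub>\<infinity>k. M k)" .
  have energy_le: "energy_density p a b u k \<le> P * (energy_density p a b u k / p k)" for k
  proof -
    have "p k * (energy_density p a b u k / p k) \<le> P * (energy_density p a b u k / p k)"
      using p_bounds(2)[of k] p0[of k] energy_nonneg[of u k] by (intro mult_right_mono) auto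
    then show ?thesis using p0[of k] by simp
  qed
  have energy_summable: "energy_density p a b u summable_on UNIV"
    by (rule summable_on_comparison_test[OF summable_on_cmult_right[OF e_summable, of P]])
      (use energy_le energy_nonneg in auto)
  have "(\<Sum>\<^sub>\<infinity>k. energy_density p a b u k) \<le> (\<Sum>\<^sub>\<infinity>k. P * (energy_density p a b u k / p k))"
    by (intro infsum_mono energy_summable summable_on_cmult_right e_summable energy_le)
  also have "\<dots> \<le> P * (\<Sum>\<^sub>\<infinity>k. M k)"
    using e_le p_bounds(1)[of 0] p_bounds(2)[of 0] p_bounds(3)
    by (subst infsum_cmult_right[OF e_summable]) (simp add: mult_left_mono)
  finally have energy_sum_le: "(\<Sum>\<^sub>\<infinity>k. energy_density p a b u k) \<le> P * (\<Sum>\<^sub>\<infinity>k. M k)" .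

  \<comment> \<open>If u_k = t, the k-th term alone would give weighted energy at least t^P / (P
    \<alpha>^P), contradicting \<open>e_le\<close> and \<open>M_small\<close>.\<close>
  have u_less: "u k < t" for k
  proof (rule ccontr)
    assume "\<not> u k < t"
    moreover have "u k \<le> t" using u by (simp add: X_iff)
    ultimately have ukt: "u k = t" by simp
    have P: "0 < P" "p k \<le> P" using p0[of k] p_bounds(2)[of k] by auto
    have \<alpha>0: "0 < \<alpha>" using t by simp
    have "1 \<le> b k * \<alpha> powr p k"
      by (rule one_le_mult_powr[OF b_pos p0 \<alpha>])
    then have "(t / \<alpha>) powr p k \<le> (b k * \<alpha> powr p k) * (t / \<alpha>) powr p k"
      using mult_right_mono[of 1 "b k * \<alpha> powr p k" "(t / \<alpha>) powr p k"] by simp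
    also have "\<dots> = b k * t powr p k"
      using t \<alpha>0 by (simp add: powr_divide)
    finally have *: "(t / \<alpha>) powr p k \<le> b k * t powr p k" .
    have "t powr P / (P * \<alpha> powr P) = (t / \<alpha>) powr P / P"
      using t by (simp add: powr_divide)
    \<comment> \<open>Since t / \<alpha> <= 1, lowering the exponent from P to p_k increases the
      power; the smaller denominator helps as well.\<close>
    also have "\<dots> \<le> (t / \<alpha>) powr p k / p k"
      using t \<alpha>0 P p0[of k] by (intro frac_le powr_mono') auto
    also have "\<dots> \<le> b k * t powr p k / p k"
      using * p0[of k] by (simp add: divide_right_mono)
    also have "\<dots> \<le> energy_density p a b u k / p k"
      using ukt t a_pos[of k] p0[of k] by (intro divide_right_mono) (auto simp: energy_density_def)
    also have "\<dots> \<le> (\<Sum>\<^sub>\<infinity>k. energy_density p a b u k / p k)"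
      using finite_sum_le_infsum[OF e_summable, of "{k}"] energy_nonneg[of u] p0
      by (auto simp: less_imp_le)
    finally show False
      using e_le M_small by (simp add: M_def)
  qed

  \<comment> \<open>Minimality with all unaffected terms cancelled. The trivial update
    \<open>u(k := u k)\<close> puts both sides on the curve that is differentiated next.\<close>
  have variation: "(\<Sum>j\<in>{k - 1, k}. A j (u(k := u k))) \<le> (\<Sum>j\<in>{k - 1, k}. A j (u(k := x)))"
    if x: "0 \<le> x" "x \<le> t" for k x
  proof -
    have "((\<lambda>j. A j (u(k := x))) has_sum ((\<Sum>\<^sub>\<infinity>j. A j u)
        + ((\<Sum>j\<in>{k - 1, k}. A j (u(k := x))) - (\<Sum>j\<in>{k - 1, k}. A j u)))) UNIV"
      by (rule has_sum_change_finite[OF u_summable])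
        (simp_all add: A_def shifted_action_upd_other)
    moreover have "u(k := x) \<in> X" using u x by (auto simp: X_iff)
    ultimately show ?thesis
      using min[of "u(k := x)"] by (simp add: has_sum_imp_summable infsumI)
  qed
  have deriv: "((\<lambda>x. \<Sum>j\<in>{k - 1, k}. A j (u(k := x))) has_real_derivative residual p a b f u k)
      (at (u k) within {0..t})" for k
    unfolding A_def
    by (rule has_field_derivative_at_within, rule shifted_action_upd_derivative) (auto intro: p1 f_cont)
  \<comment> \<open>A negative derivative would let a small increase of u_k lower the action; there
    is room for it because u_k < t.\<close>
  have residual_nonneg: "0 \<le> residual p a b f u k" for k
  proof (rule ccontr)
    assume "\<not> 0 \<le> residual p a b f u k"
    then obtain d where d: "d > 0" "\<And>h. h > 0 \<Longrightarrow> u k + h \<in> {0..t} \<Longrightarrow> h < d \<Longrightarrow>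
        (\<Sum>j\<in>{k - 1, k}. A j (u(k := u k + h))) < (\<Sum>j\<in>{k - 1, k}. A j (u(k := u k)))"
      using has_real_derivative_neg_dec_right[OF deriv[of k]] unfolding not_le by blast
    define h where "h = min (d / 2) (t - u k)"
    have "0 < h" "h < d" "u k + h \<in> {0..t}"
      using d u u_less[of k] by (auto simp: h_def X_iff min_def)
    then show False
      using d(2)[of h] variation[of "u k + h" k] by auto
  qed
  \<comment> \<open>Symmetrically, a small decrease of u_k stays in the box when u_k > 0.\<close>
  have residual_nonpos: "residual p a b f u k \<le> 0" if "0 < u k" for k
  proof (rule ccontr)
    assume "\<not> residual p a b f u k \<le> 0"
    then obtain d where d: "d > 0" "\<And>h. h > 0 \<Longrightarrow> u k - h \<in> {0..t} \<Longrightarrow> h < d \<Longrightarrow>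
        (\<Sum>j\<in>{k - 1, k}. A j (u(k := u k - h))) < (\<Sum>j\<in>{k - 1, k}. A j (u(k := u k)))"
      using has_real_derivative_pos_inc_left[OF deriv[of k]] unfolding not_le by blast
    define h where "h = min (d / 2) (u k)"
    have "0 < h" "h < d" "u k - h \<in> {0..t}"
      using d u that u_less[of k] by (auto simp: h_def X_iff min_def)
    then show False
      using d(2)[of h] variation[of "u k - h" k] by auto
  qed

  have zero_spreads: "u (k - 1) = 0 \<and> u (k + 1) = 0" if "u k = 0" for k
  proof (rule ccontr)
    assume ne: "\<not> ?thesis"
    have nonneg: "0 \<le> u (k - 1)" "0 \<le> u (k + 1)" using u by (auto simp: X_iff)
    have sp: "0 \<le> signed_pow q x" if "0 \<le> x" for q x
      using that by (simp add: signed_pow_def)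
    \<comment> \<open>With u_k = 0 and f_k(0) = 0 only the two neighbour terms of the residual
      survive. A positive neighbour would make the residual negative.\<close>
    have "0 < a (k - 1) * signed_pow (p (k - 1)) (u (k - 1)) + a k * signed_pow (p k) (u (k + 1))"
    proof (cases "u (k - 1) = 0")
      case True
      then show ?thesis
        using ne nonneg a_pos[of k] signed_pow_pos[of "u (k + 1)"] by simp
    next
      case False
      then show ?thesis
        using nonneg a_pos[of k] a_pos[of "k - 1"] sp signed_pow_pos[of "u (k - 1)"]
        by (intro add_pos_nonneg) (simp_all add: less_imp_le)
    qed
    also have "\<dots> = - residual p a b f u k"
      using that signed_pow_minus[of "p (k - 1)" "u (k - 1)"]
      by (simp add: residual_def bdiff_def fdiff_def F1)
    finally show False using residual_nonneg[of k] by simp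
  qed

  text \<open>The competitor supported at \<open>i\<close> with value \<open>s\<close> rules out the trivial minimizer.\<close>
  have "u \<noteq> (\<lambda>_. 0)"
  proof
    assume u0: "u = (\<lambda>_. 0)"
    \<comment> \<open>Since s <= 1 and the exponents are at least P', replacing them by P' in both
      power and denominator only increases the terms.\<close>
    have le: "(a (i - 1) * s powr p (i - 1)) / p (i - 1) \<le> a (i - 1) * s powr P' / P'"
         "((a i + b i) * s powr p i) / p i \<le> (a i + b i) * s powr P' / P'"
      using s p_bounds(1)[of i] p_bounds(1)[of "i - 1"] p_bounds(3)
        a_pos[of i] a_pos[of "i - 1"] b_pos[of i]
      by (auto intro!: frac_le mult_left_mono powr_mono' simp: add_nonneg_nonneg less_imp_le)
    have "(\<Sum>j\<in>{i - 1, i}. A j (u(i := s)))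
        = (a (i - 1) * s powr p (i - 1)) / p (i - 1) + ((a i + b i) * s powr p i) / p i
          - primitive f i s + (M (i - 1) + M i)"
      using s by (simp add: u0 A_def shifted_action_def energy_density_def fdiff_def M_def distrib_right)
    also have "\<dots> \<le> (a (i - 1) + a i + b i) * s powr P' / P' - primitive f i s + (M (i - 1) + M i)"
      using le by (simp add: distrib_right add_divide_distrib)
    also have "\<dots> < M (i - 1) + M i"
      using growth by simp
    also have "\<dots> = (\<Sum>j\<in>{i - 1, i}. A j (u(i := u i)))"
      by (simp add: u0 fun_upd_idem A_0)
    finally show False
      using variation[of s i] s by simp
  qed
  have u_pos: "0 < u k" for k
  proof (rule ccontr)
    assume "\<not> 0 < u k"
    moreover have "0 \<le> u k" using u by (simp add: X_iff)
    ultimately have "u k = 0" by simp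
    \<comment> \<open>Zeros propagate from k in both directions along the integers.\<close>
    then have "u j = 0" for j
      by (induction j rule: int_induct[of _ k]) (use zero_spreads in auto)
    with \<open>u \<noteq> (\<lambda>_. 0)\<close> show False by auto
  qed
  show thesis
    using that[of u] u_pos residual_nonneg residual_nonpos energy_summable energy_sum_le
    by (auto simp: M_def intro: antisym)
qed

section \<open>Norm bound, embedding and decay from finite energy\<close>

text \<open>For \<eta> <= 1, dividing u by \<eta> multiplies the k-th energy term by \<eta>^(-p_k)
  <= \<eta>^(-P), so \<eta> is admissible in the infimum.\<close>

lemma E_norm_le:
  assumes p: "\<And>k. p k \<le> P" and a_pos: "\<And>k. 0 < a k" and b_pos: "\<And>k. 0 < b k"
    and \<eta>: "0 < \<eta>" "\<eta> \<le> 1"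
    and summable: "energy_density p a b u summable_on UNIV"
    and le: "(\<Sum>\<^sub>\<infinity>k. energy_density p a b u k) \<le> \<eta> powr P"
  shows "0 \<le> E_norm p a b u" "E_norm p a b u \<le> \<eta>"
proof -
  let ?e = "\<lambda>\<eta> k. a k * \<bar>fdiff u k / \<eta>\<bar> powr p k + b k * \<bar>u k / \<eta>\<bar> powr p k"
  have scale: "?e \<eta> k \<le> \<eta> powr (- P) * energy_density p a b u k" for k
  proof -
    have "?e \<eta> k = \<eta> powr (- p k) * energy_density p a b u k"
      using \<eta> by (simp add: energy_density_def powr_divide powr_minus_divide add_divide_distrib)
    also have "\<dots> \<le> \<eta> powr (- P) * energy_density p a b u k"
      using \<eta> p[of k] a_pos[of k] b_pos[of k]
      by (intro mult_right_mono powr_mono') (auto simp: energy_density_def)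
    finally show ?thesis .
  qed
  have e_summable: "?e \<eta> summable_on UNIV"
    by (rule summable_on_comparison_test[OF summable_on_cmult_right[OF summable, of "\<eta> powr (- P)"]])
      (use scale a_pos b_pos in \<open>auto intro!: add_nonneg_nonneg mult_nonneg_nonneg simp: less_imp_le\<close>)
  have "infsum (?e \<eta>) UNIV \<le> (\<Sum>\<^sub>\<infinity>k. \<eta> powr (- P) * energy_density p a b u k)"
    by (intro infsum_mono e_summable summable_on_cmult_right summable scale)
  also have "\<dots> = \<eta> powr (- P) * (\<Sum>\<^sub>\<infinity>k. energy_density p a b u k)"
    by (rule infsum_cmult_right[OF summable])
  also have "\<dots> \<le> \<eta> powr (- P) * \<eta> powr P"
    by (intro mult_left_mono le) simp
  also have "\<dots> = 1" using \<eta> by (simp flip: powr_add)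
  finally have mem: "\<eta> \<in> {\<eta>. \<eta> > 0 \<and> ?e \<eta> summable_on UNIV \<and> infsum (?e \<eta>) UNIV \<le> 1}"
    using \<eta> e_summable by simp
  \<comment> \<open>The lower bound too rests on \<open>mem\<close>: the infimum is over a nonempty
    set of positive reals.\<close>
  show "0 \<le> E_norm p a b u"
    unfolding E_norm_def by (rule cInf_greatest) (use mem in auto)
  show "E_norm p a b u \<le> \<eta>"
    unfolding E_norm_def by (rule cInf_lower[OF mem]) (auto intro: bdd_belowI[of _ 0])
qed

lemma eventually_at_inf_int:
  "eventually Q at_inf_int \<longleftrightarrow> (\<exists>N. \<forall>k. N \<le> \<bar>k\<bar> \<longrightarrow> Q k)"
  unfolding at_inf_int_def eventually_filtercomap eventually_at_top_linorder by blast

text \<open>Outside a finite window b_k >= 1, so the values there are at most 1. Boundedness makes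
  the real supremum a genuine upper bound.\<close>

lemma embed_const_bdd_above:
  fixes p b :: "int \<Rightarrow> real"
  assumes A: "filterlim b at_top at_inf_int" and p: "\<And>k. 0 < p k"
  shows "bdd_above (range (\<lambda>k. b k powr (- 1 / p k)))"
proof -
  have "eventually (\<lambda>k. 1 \<le> b k) at_inf_int"
    using A by (simp add: filterlim_at_top)
  then obtain N where N: "\<And>k. N \<le> \<bar>k\<bar> \<Longrightarrow> 1 \<le> b k"
    by (auto simp: eventually_at_inf_int)
  have fin: "finite {-N..N}" by simp
  have "bdd_above ((\<lambda>k. b k powr (- 1 / p k)) ` {-N..N} \<union> {..1})"
    using bdd_above_finite[OF finite_imageI[OF fin]] by simp
  moreover have "range (\<lambda>k. b k powr (- 1 / p k)) \<subseteq> (\<lambda>k. b k powr (- 1 / p k)) ` {-N..N} \<union> {..1}"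
  proof (rule image_subsetI)
    fix k
    show "b k powr (- 1 / p k) \<in> (\<lambda>k. b k powr (- 1 / p k)) ` {-N..N} \<union> {..1}"
    proof (cases "N \<le> \<bar>k\<bar>")
      case True
      then show ?thesis
        using powr_mono[of "- 1 / p k" 0 "b k"] N[of k] p[of k] by simp
    next
      case False
      then have "k \<in> {-N..N}" by auto
      then show ?thesis by blast
    qed
  qed
  ultimately show ?thesis by (rule bdd_above_mono)
qed

lemma lp_var_if_energy_summable:
  assumes p: "\<And>k. 0 < p k" "\<And>k. p k \<le> P" and a_pos: "\<And>k. 0 < a k" and b_pos: "\<And>k. 0 < b k"
    and \<alpha>: "\<And>k. b k powr (- 1 / p k) \<le> \<alpha>"
    and summable: "energy_density p a b u summable_on UNIV"
  shows "u \<in> lp_var p"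
  unfolding lp_var_def mem_Collect_eq
proof (rule summable_on_comparison_test)
  \<comment> \<open>A base of at least 1 allows p_k to be raised to P, so that C b_k >= 1 with C
    independent of k.\<close>
  define C where "C = max 1 \<alpha> powr P"
  show "(\<lambda>k. C * energy_density p a b u k) summable_on UNIV"
    by (intro summable_on_cmult_right summable)
  fix k
  have "1 \<le> b k * max 1 \<alpha> powr p k"
    using \<alpha>[of k] by (intro one_le_mult_powr b_pos p) auto
  also have "\<dots> \<le> b k * C"
    unfolding C_def using p(2)[of k] b_pos[of k] by (intro mult_left_mono powr_mono) auto
  finally have "1 \<le> C * b k"
    by (simp add: mult.commute)
  then have "\<bar>u k\<bar> powr p k \<le> C * b k * \<bar>u k\<bar> powr p k"
    using mult_right_mono[of 1 "C * b k" "\<bar>u k\<bar> powr p k"] by simp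
  also have "\<dots> \<le> C * energy_density p a b u k"
    using a_pos[of k] by (simp add: energy_density_def C_def distrib_left mult.assoc)
  finally show "\<bar>u k\<bar> powr p k \<le> C * energy_density p a b u k" .
qed simp

lemma tendsto_0_if_energy_summable:
  assumes p: "\<And>k. 0 < p k" "\<And>k. p k \<le> P" and a_pos: "\<And>k. 0 < a k" and b_pos: "\<And>k. 0 < b k"
    and A: "filterlim b at_top at_inf_int"
    and summable: "energy_density p a b u summable_on UNIV"
  shows "(u \<longlongrightarrow> 0) at_inf_int"
proof (rule tendstoI)
  fix e :: real assume e: "0 < e"
  define S where "S = (\<Sum>\<^sub>\<infinity>k. energy_density p a b u k)"
  define d where "d = min e 1"
  have d: "0 < d" "d \<le> 1" "d \<le> e" using e by (auto simp: d_def)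
  \<comment> \<open>Beyond this threshold b_k d^P > S, so |u_k| >= e would make one energy term
    exceed the total S. Taking d <= 1 gives d^P <= d^(p_k).\<close>
  have "eventually (\<lambda>k. S / d powr P < b k) at_inf_int"
    using A by (simp add: filterlim_at_top_dense)
  then show "eventually (\<lambda>k. dist (u k) 0 < e) at_inf_int"
  proof eventually_elim
    case (elim k)
    show ?case
    proof (rule ccontr)
      assume "\<not> dist (u k) 0 < e"
      then have "d powr p k \<le> \<bar>u k\<bar> powr p k"
        using d p(1)[of k] by (intro powr_mono2) auto
      moreover have "d powr P \<le> d powr p k"
        using d p(2)[of k] by (intro powr_mono') auto
      ultimately have "b k * d powr P \<le> b k * \<bar>u k\<bar> powr p k"
        using b_pos[of k] by simp
      also have "\<dots> \<le> energy_density p a b u k"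
        using a_pos[of k] by (simp add: energy_density_def)
      also have "\<dots> \<le> S"
        using finite_sum_le_infsum[OF summable, of "{k}"] energy_density_nonneg[OF a_pos b_pos]
        by (simp add: S_def)
      finally show False using elim d by (simp add: field_simps)
    qed
  qed
qed

section \<open>From the asymptotic conditions to solutions of arbitrarily small norm\<close>

text \<open>If the ratio were at most c for all k and all 0 < s < \<delta>, each upper limit in (F5)
  and (F6) would be at most c. Both alternatives thus supply one witness (k, s).\<close>

lemma growth_ratio_large_near_0:
  assumes "max (Limsup (at_top \<times>\<^sub>F at_right 0) (\<lambda>(k, t). ereal (growth_ratio p a b f k t)))
           (Limsup (at_bot \<times>\<^sub>F at_right 0) (\<lambda>(k, t). ereal (growth_ratio p a b f k t))) > ereal c
       \<or> (SUP k. Limsup (at_right 0) (\<lambda>t. ereal (growth_ratio p a b f k t))) > ereal c"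
    and "0 < \<delta>"
  shows "\<exists>k s. 0 < s \<and> s < \<delta> \<and> c < growth_ratio p a b f k s"
proof (rule ccontr)
  assume "\<not> ?thesis"
  then have le: "growth_ratio p a b f k s \<le> c" if "0 < s" "s < \<delta>" for k s
    using that by (meson not_le)
  have near: "eventually (\<lambda>s. 0 < s \<and> s < \<delta>) (at_right (0::real))"
    using \<open>0 < \<delta>\<close> by (auto simp: eventually_at_right_field)
  have "Limsup (F \<times>\<^sub>F at_right 0) (\<lambda>(k, t). ereal (growth_ratio p a b f k t)) \<le> ereal c" for F
    using eventually_compose_filterlim[OF near filterlim_snd, of F]
    by (intro Limsup_bounded) (auto elim!: eventually_mono simp: le)
  moreover have "(SUP k. Limsup (at_right 0) (\<lambda>t. ereal (growth_ratio p a b f k t))) \<le> ereal c"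
    by (intro SUP_least Limsup_bounded eventually_mono[OF near]) (simp add: le)
  ultimately show False
    using assms(1) by (auto simp: less_max_iff_disj not_less[symmetric])
qed

theorem theorem3:
  fixes p a b :: "int \<Rightarrow> real" and f :: "int \<Rightarrow> real \<Rightarrow> real"
  assumes p_bdd: "bdd_below (range p)" "bdd_above (range p)"
    and p_gt: "1 < p_minus p"
    and a_pos: "\<And>k. 0 < a k"
    and b_pos: "\<And>k. 0 < b k"
    and f_cont: "\<And>k. continuous_on UNIV (f k)"
    and A: "filterlim b at_top at_inf_int"
    and F1: "\<And>k. f k 0 = 0"
    and F2: "\<And>T. 0 < T \<Longrightarrow> (\<lambda>k. SUP t\<in>{-T..T}. \<bar>f k t\<bar>) summable_on UNIV"
    and F4: "Liminf (at_right 0)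
               (\<lambda>t. ereal ((\<Sum>\<^sub>\<infinity>k. SUP \<xi>\<in>{-t..t}. primitive f k \<xi>) / t powr p_plus p))
             < ereal (1 / (p_plus p * embed_const p b powr p_plus p))"
    and F5_or_F6:
      "max (Limsup (at_top \<times>\<^sub>F at_right 0) (\<lambda>(k, t). ereal (growth_ratio p a b f k t)))
           (Limsup (at_bot \<times>\<^sub>F at_right 0) (\<lambda>(k, t). ereal (growth_ratio p a b f k t)))
         > ereal (1 / p_minus p)
       \<or> (SUP k. Limsup (at_right 0) (\<lambda>t. ereal (growth_ratio p a b f k t)))
         > ereal (1 / p_minus p)"
  shows "\<exists>u :: nat \<Rightarrow> int \<Rightarrow> real.
           (\<forall>n. u n \<in> E_space p a b \<and> solution p a b f (u n) \<and> (\<forall>k. 0 < u n k)) \<and>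
           (\<lambda>n. E_norm p a b (u n)) \<longlonglongrightarrow> 0"
proof -
  define \<alpha> where "\<alpha> = embed_const p b"
  define P where "P = p_plus p"
  define Q where "Q = p_minus p"
  define M where "M t = (\<Sum>\<^sub>\<infinity>k. SUP \<xi>\<in>{-t..t}. primitive f k \<xi>)" for t
  have pQ: "Q \<le> p k" and pP: "p k \<le> P" for k
    using p_bdd by (auto simp: Q_def P_def p_minus_def p_plus_def intro: cINF_lower cSUP_upper)
  have Q: "1 < Q" using p_gt by (simp add: Q_def)
  have p0: "0 < p k" for k using pQ[of k] Q by linarith
  have P0: "0 < P" using p0[of 0] pP[of 0] by linarith
  have \<alpha>: "b k powr (- 1 / p k) \<le> \<alpha>" for k
    unfolding \<alpha>_def embed_const_def by (intro cSUP_upper embed_const_bdd_above A p0) simp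
  have \<alpha>0: "0 < \<alpha>"
    using \<alpha>[of 0] b_pos[of 0] by (smt (verit) powr_gt_zero)
  have ex: "\<exists>u. u \<in> E_space p a b \<and> solution p a b f u \<and> (\<forall>k. 0 < u k) \<and>
      0 \<le> E_norm p a b u \<and> E_norm p a b u \<le> \<eta>" if \<eta>: "0 < \<eta>" "\<eta> \<le> 1" for \<eta>
  proof -
    \<comment> \<open>A strict upper bound on the lower limit is attained at points arbitrarily
      close to 0. The range t < \<eta> \<alpha> is what later bounds the norm by \<eta>.\<close>
    have "\<exists>t. 0 < t \<and> t < \<eta> * \<alpha> \<and> M t / t powr P < 1 / (P * \<alpha> powr P)"
    proof (rule ccontr)
      assume "\<not> ?thesis"
      then have "1 / (P * \<alpha> powr P) \<le> M t / t powr P" if "0 < t" "t < \<eta> * \<alpha>" for t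
        using that by force
      moreover have "eventually (\<lambda>t. 0 < t \<and> t < \<eta> * \<alpha>) (at_right (0::real))"
        using \<eta> \<alpha>0 by (auto simp: eventually_at_right_field intro!: exI[of _ "\<eta> * \<alpha>"])
      ultimately have "ereal (1 / (P * \<alpha> powr P)) \<le> Liminf (at_right 0) (\<lambda>t. ereal (M t / t powr P))"
        by (intro Liminf_bounded) (auto elim!: eventually_mono)
      with F4 show False by (simp add: M_def P_def \<alpha>_def)
    qed
    then obtain t where t: "0 < t" "t < \<eta> * \<alpha>" and "M t / t powr P < 1 / (P * \<alpha> powr P)"
      by blast
    then have M_small: "M t < t powr P / (P * \<alpha> powr P)"
      by (simp add: field_simps)
    have t\<alpha>: "t \<le> \<alpha>"
      using t \<eta> \<alpha>0 mult_right_mono[of \<eta> 1 \<alpha>] by linarith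
    \<comment> \<open>Below t the competitor stays in the box; below 1 its powers can be compared
      with s^(p^-).\<close>
    obtain i s where s: "0 < s" "s < min t 1" and "1 / Q < growth_ratio p a b f i s"
      using growth_ratio_large_near_0[OF F5_or_F6, of "min t 1"] t unfolding Q_def by auto
    moreover have "0 < (a (i - 1) + a i + b i) * s powr Q"
      using a_pos[of i] a_pos[of "i - 1"] b_pos[of i] s by simp
    ultimately have growth: "(a (i - 1) + a i + b i) * s powr Q / Q < primitive f i s"
      using Q by (simp add: growth_ratio_def Q_def[symmetric] pos_less_divide_eq)
    obtain u where u: "\<And>k. 0 < u k" "\<And>k. residual p a b f u k = 0"
        "energy_density p a b u summable_on UNIV"
        "(\<Sum>\<^sub>\<infinity>k. energy_density p a b u k) \<le> P * M t"
    proof (rule small_positive_solution[of Q p P a b f \<alpha> t s i])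
      show "(\<lambda>k. SUP \<xi>\<in>{-t..t}. primitive f k \<xi>) summable_on UNIV"
        by (intro primitive_Sup_summable f_cont F2 t)
    qed (use pQ pP Q a_pos b_pos f_cont F1 \<alpha> t t\<alpha> M_small s growth in \<open>auto simp: M_def\<close>)
    \<comment> \<open>The factor 1/P in (F4) absorbs the P lost in passing from the weighted to the
      plain energy.\<close>
    have "P * M t \<le> (t / \<alpha>) powr P"
      using M_small P0 \<alpha>0 t by (simp add: field_simps powr_divide)
    also have "\<dots> \<le> \<eta> powr P"
      using t \<alpha>0 P0 by (intro powr_mono2) (auto simp: field_simps)
    finally have "(\<Sum>\<^sub>\<infinity>k. energy_density p a b u k) \<le> \<eta> powr P"
      using u(4) by simp
    then have "0 \<le> E_norm p a b u" "E_norm p a b u \<le> \<eta>"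
      using E_norm_le[of p P a b \<eta> u] pP a_pos b_pos \<eta> u(3) by auto
    moreover have "u \<in> E_space p a b"
      using lp_var_if_energy_summable[of p P a b \<alpha> u] p0 pP a_pos b_pos \<alpha> u(3)
      by (simp add: E_space_def)
    moreover have "solution p a b f u"
      using tendsto_0_if_energy_summable[of p P a b u] p0 pP a_pos b_pos A u(2,3)
      by (simp add: solution_def residual_def)
    ultimately show ?thesis using u(1) by blast
  qed
  have "\<forall>n. \<exists>u. u \<in> E_space p a b \<and> solution p a b f u \<and> (\<forall>k. 0 < u k) \<and>
      0 \<le> E_norm p a b u \<and> E_norm p a b u \<le> inverse (real (Suc n))"
    by (intro allI ex) (auto simp: field_simps)
  then obtain u where u: "\<And>n. u n \<in> E_space p a b \<and> solution p a b f (u n) \<and> (\<forall>k. 0 < u n k) \<and>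
      0 \<le> E_norm p a b (u n) \<and> E_norm p a b (u n) \<le> inverse (real (Suc n))"
    by metis
  moreover have "(\<lambda>n. E_norm p a b (u n)) \<longlonglongrightarrow> 0"
    by (rule tendsto_sandwich[OF _ _ tendsto_const LIMSEQ_inverse_real_of_nat]) (use u in auto)
  ultimately show ?thesis by blast
qed

end
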